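(* Let $k, r, n$ be integers with $2 \le k < r < n$, and let $H$ be a $k$-uniform hypergraph on a vertex set $V$ with $|V| = n$. Set $t = n-k$ and $s = r-k$. Let $R$ be the complementary hypergraph of $H$, i.e. the $t$-uniform hypergraph on $V$ whose edge set is $\{S \in \binom{V}{t} : V \setminus S \notin E(H)\}$. Then $H$ is a primitive uniquely $K_r^{(k)}$-saturated hypergraph if and only if $R$ satisfies all three of the following properties: (1) every $(t-s)$-subset of $V$ is contained in some edge of $R$; (2) every edge of $R$ contains exactly one $(t-s)$-subset that is contained in no other edge of $R$; (3) no vertex of $V$ belongs to every edge of $R$.
   Context: $K_r^{(k)}$ denotes the complete $k$-uniform hypergraph on $r$ vertices. A $k$-uniform hypergraph $H$ is uniquely $K_r^{(k)}$-saturated if $H$ contains no copy of $K_r^{(k)}$ (i.e., no $r$-set of vertices all of whose $k$-subsets are edges), and for every $k$-subset $S$ of $V(H)$ that is not an edge of $H$, the hypergraph $H+S$ contains exactly one copy of $K_r^{(k)}$. A vertex $v$ is dominating in $H$ if every $k$-subset of $V(H)$ containing $v$ is an edge of $H$. $H$ is primitive uniquely $K_r^{(k)}$-saturated if it is uniquely $K_r^{(k)}$-saturated and has no dominating vertex. *)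

theory Defs
  imports Main "HOL-Library.Ramsey"
begin

text \<open>
  A hypergraph is given by its vertex set \<open>V\<close> and its edge set \<open>E\<close>.  The \<open>k\<close>-subsets of \<open>V\<close>
  are \<open>[V]\<^bsup>k\<^esup>\<close> (the constant \<^const>\<open>nsets\<close>).
\<close>

definition uniform_hypergraph :: "nat \<Rightarrow> 'a set \<Rightarrow> 'a set set \<Rightarrow> bool" where
  "uniform_hypergraph k V E \<longleftrightarrow> finite V \<and> E \<subseteq> [V]\<^bsup>k\<^esup>"

text \<open>
  A copy of the complete \<open>k\<close>-uniform hypergraph on \<open>r\<close> vertices is identified with its vertex set.
\<close>

definition complete_copy :: "nat \<Rightarrow> nat \<Rightarrow> 'a set \<Rightarrow> 'a set set \<Rightarrow> 'a set \<Rightarrow> bool" where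
  "complete_copy k r V E W \<longleftrightarrow> W \<in> [V]\<^bsup>r\<^esup> \<and> [W]\<^bsup>k\<^esup> \<subseteq> E"

definition uniquely_saturated :: "nat \<Rightarrow> nat \<Rightarrow> 'a set \<Rightarrow> 'a set set \<Rightarrow> bool" where
  "uniquely_saturated k r V E \<longleftrightarrow>
     \<not> (\<exists>W. complete_copy k r V E W) \<and>
     (\<forall>S \<in> [V]\<^bsup>k\<^esup> - E. \<exists>!W. complete_copy k r V (insert S E) W)"

definition dominating :: "nat \<Rightarrow> 'a set \<Rightarrow> 'a set set \<Rightarrow> 'a \<Rightarrow> bool" where
  "dominating k V E v \<longleftrightarrow> v \<in> V \<and> (\<forall>S \<in> [V]\<^bsup>k\<^esup>. v \<in> S \<longrightarrow> S \<in> E)"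

definition primitive_uniquely_saturated :: "nat \<Rightarrow> nat \<Rightarrow> 'a set \<Rightarrow> 'a set set \<Rightarrow> bool" where
  "primitive_uniquely_saturated k r V E \<longleftrightarrow>
     uniquely_saturated k r V E \<and> \<not> (\<exists>v. dominating k V E v)"

text \<open>
  The edges of the complementary hypergraph of a \<open>k\<close>-uniform hypergraph on \<open>V\<close>; they are the
  complements of the non-edges, so the relevant uniformity is \<open>t = card V - k\<close>.
\<close>

definition complementary :: "nat \<Rightarrow> 'a set \<Rightarrow> 'a set set \<Rightarrow> 'a set set" where
  "complementary t V E = {S \<in> [V]\<^bsup>t\<^esup>. V - S \<notin> E}"

end

theory Submission
  imports Defs
begin

text \<open>
  Complementation in \<open>V\<close> exchanges \<open>r\<close>-sets and \<open>(t - s)\<close>-sets, and non-edges of \<open>E\<close> and edges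
  of \<open>R\<close>, reversing inclusions.  An \<open>r\<close>-set \<open>W\<close> is a copy of the complete hypergraph precisely
  when \<open>V - W\<close> lies in no edge of \<open>R\<close>, so (1) says that there is no copy; and \<open>W\<close> is a copy
  after adding the non-edge \<open>S\<close> precisely when \<open>V - W\<close> lies in no edge of \<open>R\<close> other than
  \<open>V - S\<close>, which given (1) forces \<open>V - W \<subseteq> V - S\<close>, so (2) is unique saturation.
  A vertex is dominating precisely when it lies in every edge of \<open>R\<close>.
\<close>

lemma Diff_in_nsets:
  assumes "finite V" "S \<in> [V]\<^bsup>k\<^esup>"
  shows "V - S \<in> [V]\<^bsup>(card V - k)\<^esup>"
  using assms by (auto simp: nsets_def card_Diff_subset)

lemma bij_betw_Diff_nsets:
  assumes "finite V" "r \<le> card V"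
  shows "bij_betw (\<lambda>A. V - A) ([V]\<^bsup>(card V - r)\<^esup>) ([V]\<^bsup>r\<^esup>)"
proof (rule bij_betw_byWitness[where f' = "\<lambda>W. V - W"])
  \<comment> \<open>Subtraction is truncated, so \<open>card V - (card V - r) = r\<close> relies on
    \<open>r \<le> card V\<close>.\<close>
  show "(\<lambda>A. V - A) ` [V]\<^bsup>(card V - r)\<^esup> \<subseteq> [V]\<^bsup>r\<^esup>"
    using Diff_in_nsets[OF assms(1), of _ "card V - r"] assms(2) by auto
  show "(\<lambda>W. V - W) ` [V]\<^bsup>r\<^esup> \<subseteq> [V]\<^bsup>(card V - r)\<^esup>"
    using Diff_in_nsets[OF assms(1)] by auto
qed (auto simp: nsets_def)

lemma Diff_in_complementary:
  assumes "finite V" "S \<in> [V]\<^bsup>k\<^esup> - E"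
  shows "V - S \<in> complementary (card V - k) V E"
proof -
  have "V - (V - S) = S"
    using assms(2) by (auto simp: nsets_def)
  then show ?thesis
    using assms Diff_in_nsets[of V S k] by (simp add: complementary_def)
qed

text \<open>Lets quantifiers over edges of the complementary hypergraph be read as quantifiers over
  non-edges \<open>S\<close>, with \<open>V - S\<close> as the edge.\<close>

lemma complementary_eq_image:
  assumes "finite V" "k \<le> card V"
  shows "complementary (card V - k) V E = (\<lambda>S. V - S) ` ([V]\<^bsup>k\<^esup> - E)"
proof
  show "complementary (card V - k) V E \<subseteq> (\<lambda>S. V - S) ` ([V]\<^bsup>k\<^esup> - E)"
  proof
    fix e assume e: "e \<in> complementary (card V - k) V E"
    then have "V - e \<in> [V]\<^bsup>k\<^esup> - E"
      using bij_betwE[OF bij_betw_Diff_nsets[OF assms]] by (auto simp: complementary_def)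
    moreover have "e = V - (V - e)"
      using e by (auto simp: complementary_def nsets_def)
    ultimately show "e \<in> (\<lambda>S. V - S) ` ([V]\<^bsup>k\<^esup> - E)" by blast
  qed
qed (use Diff_in_complementary[OF assms(1)] in blast)

lemma complete_copy_Diff_iff:
  assumes "finite V" "k \<le> card V" "r \<le> card V" "A \<in> [V]\<^bsup>(card V - r)\<^esup>"
  shows "complete_copy k r V E (V - A) \<longleftrightarrow>
    \<not> (\<exists>f \<in> complementary (card V - k) V E. A \<subseteq> f)"
proof -
  have "V - A \<in> [V]\<^bsup>r\<^esup>"
    using bij_betwE[OF bij_betw_Diff_nsets[OF assms(1,3)]] assms(4) by blast
  then have "complete_copy k r V E (V - A) \<longleftrightarrow> \<not> (\<exists>S \<in> [V]\<^bsup>k\<^esup> - E. S \<subseteq> V - A)"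
    by (auto simp: complete_copy_def nsets_def)
  \<comment> \<open>For subsets \<open>S\<close> and \<open>A\<close> of \<open>V\<close>, both
    inclusions say that \<open>S\<close> and \<open>A\<close> are disjoint.\<close>
  also have "(\<exists>S \<in> [V]\<^bsup>k\<^esup> - E. S \<subseteq> V - A) \<longleftrightarrow> (\<exists>S \<in> [V]\<^bsup>k\<^esup> - E. A \<subseteq> V - S)"
    using assms(4) by (intro bex_cong refl) (auto simp: nsets_def)
  finally show ?thesis
    by (simp add: complementary_eq_image[OF assms(1,2)])
qed

text \<open>Among subsets of \<open>V\<close>, only \<open>V - S\<close> has complement
  \<open>S\<close>; this is where \<open>S \<subseteq> V\<close> enters.\<close>

lemma complementary_insert:
  assumes "S \<subseteq> V"
  shows "complementary t V (insert S E) = complementary t V E - {V - S}"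
  using assms by (auto simp: complementary_def nsets_def)

text \<open>Carries uniqueness of a copy \<open>W\<close> over to uniqueness of
  \<open>A = V - W\<close>. The second assumption keeps every solution within the range of
  \<open>g\<close>.\<close>

lemma Ex1_bij_betw:
  assumes "bij_betw g X Y" "\<And>y. P y \<Longrightarrow> y \<in> Y"
  shows "(\<exists>!y. P y) \<longleftrightarrow> (\<exists>!x. x \<in> X \<and> P (g x))"
proof
  assume "\<exists>!y. P y"
  then obtain y where y: "P y" "\<And>z. P z \<Longrightarrow> z = y" by blast
  then obtain x where x: "x \<in> X" "y = g x"
    using assms(2)[of y] bij_betw_imp_surj_on[OF assms(1)] by blast
  show "\<exists>!x. x \<in> X \<and> P (g x)"
  proof (rule ex1I)
    show "x \<in> X \<and> P (g x)"
      using x y(1) by simp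
    show "x' = x" if "x' \<in> X \<and> P (g x')" for x'
      using that x y(2)[of "g x'"] inj_onD[OF bij_betw_imp_inj_on[OF assms(1)], of x' x] by simp
  qed
next
  assume "\<exists>!x. x \<in> X \<and> P (g x)"
  then obtain x where x: "x \<in> X" "P (g x)" "\<And>x'. x' \<in> X \<Longrightarrow> P (g x') \<Longrightarrow> x' = x" by blast
  show "\<exists>!y. P y"
  proof (rule ex1I)
    show "P (g x)" by (rule x(2))
    show "y = g x" if y: "P y" for y
    proof -
      obtain x' where "x' \<in> X" "y = g x'"
        using assms(2)[OF y] bij_betw_imp_surj_on[OF assms(1)] by blast
      then show ?thesis
        using x(3) y by blast
    qed
  qed
qed

text \<open>A vertex of \<open>V\<close> is dominating when it avoids every non-edge
  \<open>S\<close>, that is, when it lies in every \<open>V - S\<close>.\<close>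

lemma dominating_iff:
  assumes "finite V" "k \<le> card V"
  shows "dominating k V E v \<longleftrightarrow> v \<in> V \<and> (\<forall>e \<in> complementary (card V - k) V E. v \<in> e)"
  by (auto simp: dominating_def complementary_eq_image[OF assms])

lemma uniquely_saturated_iff:
  fixes E :: "'a set set"
  assumes "finite V" "k \<le> card V" "r \<le> card V"
  defines "R \<equiv> complementary (card V - k) V E"
  shows "uniquely_saturated k r V E \<longleftrightarrow>
    (\<forall>A \<in> [V]\<^bsup>(card V - r)\<^esup>. \<exists>e \<in> R. A \<subseteq> e) \<and>
    (\<forall>e \<in> R. \<exists>!A. A \<in> [e]\<^bsup>(card V - r)\<^esup> \<and> \<not> (\<exists>f \<in> R. f \<noteq> e \<and> A \<subseteq> f))"
proof -
  note bij = bij_betw_Diff_nsets[OF assms(1,3)]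
  note copy_iff = complete_copy_Diff_iff[OF assms(1-3)]
  have in_nsets: "W \<in> [V]\<^bsup>r\<^esup>" if "complete_copy k r V F W" for F W
    using that by (simp add: complete_copy_def)
  have "(\<exists>W. complete_copy k r V E W) \<longleftrightarrow> (\<exists>W \<in> [V]\<^bsup>r\<^esup>. complete_copy k r V E W)"
    using in_nsets by blast
  also have "\<dots> \<longleftrightarrow> (\<exists>A \<in> [V]\<^bsup>(card V - r)\<^esup>. complete_copy k r V E (V - A))"
    by (simp flip: bij_betw_imp_surj_on[OF bij])
  also have "\<dots> \<longleftrightarrow> \<not> (\<forall>A \<in> [V]\<^bsup>(card V - r)\<^esup>. \<exists>e \<in> R. A \<subseteq> e)"
    by (simp add: copy_iff R_def)
  finally have no_copy: "\<not> (\<exists>W. complete_copy k r V E W) \<longleftrightarrow>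
      (\<forall>A \<in> [V]\<^bsup>(card V - r)\<^esup>. \<exists>e \<in> R. A \<subseteq> e)"
    by blast
  define Q where "Q e \<longleftrightarrow> (\<exists>!A. A \<in> [e]\<^bsup>(card V - r)\<^esup> \<and> \<not> (\<exists>f \<in> R. f \<noteq> e \<and> A \<subseteq> f))" for e
  have unique_copy: "(\<exists>!W. complete_copy k r V (insert S E) W) \<longleftrightarrow> Q (V - S)"
    if cover: "\<forall>A \<in> [V]\<^bsup>(card V - r)\<^esup>. \<exists>e \<in> R. A \<subseteq> e" and S: "S \<in> [V]\<^bsup>k\<^esup> - E" for S
  proof -
    have R_insert: "complementary (card V - k) V (insert S E) = R - {V - S}"
      using S unfolding R_def by (intro complementary_insert) (auto simp: nsets_def)
    have "(\<exists>!W. complete_copy k r V (insert S E) W) \<longleftrightarrow>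
        (\<exists>!A. A \<in> [V]\<^bsup>(card V - r)\<^esup> \<and> complete_copy k r V (insert S E) (V - A))"
      using bij in_nsets by (rule Ex1_bij_betw)
    also have "\<dots> \<longleftrightarrow> (\<exists>!A. A \<in> [V]\<^bsup>(card V - r)\<^esup> \<and> \<not> (\<exists>f \<in> R. f \<noteq> V - S \<and> A \<subseteq> f))"
      by (simp add: copy_iff R_insert Bex_def conj_ac cong: conj_cong)
    also have "\<dots> \<longleftrightarrow> (\<exists>!A. A \<in> [V - S]\<^bsup>(card V - r)\<^esup> \<and> \<not> (\<exists>f \<in> R. f \<noteq> V - S \<and> A \<subseteq> f))"
    proof -
      \<comment> \<open>By \<open>cover\<close> some edge of \<open>R\<close> contains
        \<open>A\<close>, and every edge other than \<open>V - S\<close> is excluded.\<close>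
      have "A \<subseteq> V - S" if "A \<in> [V]\<^bsup>(card V - r)\<^esup>" "\<not> (\<exists>f \<in> R. f \<noteq> V - S \<and> A \<subseteq> f)" for A
        using cover that by blast
      then have "A \<in> [V]\<^bsup>(card V - r)\<^esup> \<and> \<not> (\<exists>f \<in> R. f \<noteq> V - S \<and> A \<subseteq> f) \<longleftrightarrow>
          A \<in> [V - S]\<^bsup>(card V - r)\<^esup> \<and> \<not> (\<exists>f \<in> R. f \<noteq> V - S \<and> A \<subseteq> f)" for A
        unfolding nsets_def by blast
      then show ?thesis
        by presburger
    qed
    finally show ?thesis
      by (simp only: Q_def)
  qed
  have "(\<forall>e \<in> R. Q e) \<longleftrightarrow> (\<forall>S \<in> [V]\<^bsup>k\<^esup> - E. Q (V - S))"
    unfolding R_def complementary_eq_image[OF assms(1,2)] by blast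
  also have "\<dots> \<longleftrightarrow> (\<forall>S \<in> [V]\<^bsup>k\<^esup> - E. \<exists>!W. complete_copy k r V (insert S E) W)"
    if "\<forall>A \<in> [V]\<^bsup>(card V - r)\<^esup>. \<exists>e \<in> R. A \<subseteq> e"
    using unique_copy[OF that] by (simp only: cong: ball_cong)
  \<comment> \<open>The chain is an equivalence only under the covering condition. This suffices,
    because \<open>conj_cong\<close> lets the first conjunct be assumed while the second ones are
    compared.\<close>
  finally show ?thesis
    unfolding uniquely_saturated_def no_copy Q_def[symmetric]
    by (intro conj_cong refl) simp
qed

theorem theorem1:
  fixes k r n t s :: nat and V :: "'a set" and E R :: "'a set set"
  assumes "2 \<le> k" and "k < r" and "r < n"
    and "uniform_hypergraph k V E" and "card V = n"
    and "t = n - k" and "s = r - k"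
    and "R = complementary t V E"
  shows "primitive_uniquely_saturated k r V E \<longleftrightarrow>
    (\<forall>A \<in> [V]\<^bsup>(t - s)\<^esup>. \<exists>e \<in> R. A \<subseteq> e) \<and>
    (\<forall>e \<in> R. \<exists>!A. A \<in> [e]\<^bsup>(t - s)\<^esup> \<and> \<not> (\<exists>f \<in> R. f \<noteq> e \<and> A \<subseteq> f)) \<and>
    \<not> (\<exists>v \<in> V. \<forall>e \<in> R. v \<in> e)"
proof -
  have "finite V" and k: "k \<le> card V" and r: "r \<le> card V"
    using assms by (auto simp: uniform_hypergraph_def)
  \<comment> \<open>Since \<open>k < r < n\<close>, no subtraction is truncated and
    \<open>(n - k) - (r - k) = n - r\<close>.\<close>
  have ts: "t - s = card V - r" and R: "R = complementary (card V - k) V E"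
    using assms by auto
  show ?thesis
    unfolding primitive_uniquely_saturated_def ts R
      uniquely_saturated_iff[OF \<open>finite V\<close> k r] dominating_iff[OF \<open>finite V\<close> k]
    by (simp only: Bex_def conj_assoc)
qed

end
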